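(* There exists a sequence $(C_p)_{p\ge 0}$ of rational numbers such that $\psi(2p+1) = C_p\,\pi^{2p+1}$ for every integer $p\ge 0$. The terms of this sequence are determined by $C_0=\frac14$ and by the recurrence relation $$\forall p\ge 1,\quad C_p = \frac{(-1)^p}{(2p+1)!}\left(\frac{1}{4^{p+1}} - \sum_{k=0}^{p-1}(-1)^k\frac{(2p+1)!}{(2p+1-2k)!}C_k\right).$$
   Context: For real $x>0$, $\psi(x)=\sum_{m=0}^{+\infty}\frac{(-1)^m}{(2m+1)^x}$ (for $x\le 1$ the series converges only conditionally, and the sum is the limit of the partial sums). *)

theory Defs
  imports Complex_Main
begin

(* Meaningful for x > 0 only. The series is an ordered sum (limit of the partial
   sums), hence suminf and not an unordered sum such as infsum. *)
definition psi :: "real \<Rightarrow> real" where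
  "psi x = (\<Sum>m. (-1) ^ m / (2 * real m + 1) powr x)"

lemma psi_summable:
  assumes "x > 0"
  shows "summable (\<lambda>m. (-1) ^ m / (2 * real m + 1) powr x)"
proof -
  have "filterlim (\<lambda>m. 1 + real m * 2) at_top sequentially"
    by (intro filterlim_tendsto_add_at_top[OF tendsto_const]
        filterlim_at_top_mult_tendsto_pos[OF tendsto_const] filterlim_real_sequentially) auto
  then have "((\<lambda>m. (1 + real m * 2) powr (- x)) \<longlonglongrightarrow> 0)"
    using assms by (intro tendsto_neg_powr) auto
  then have lim: "(\<lambda>m. 1 / (2 * real m + 1) powr x) \<longlonglongrightarrow> 0"
    by (simp add: powr_minus_divide add.commute mult.commute)
  have "monoseq (\<lambda>m. 1 / (2 * real m + 1) powr x)"
    using assms by (intro decseq_imp_monoseq) (auto simp: decseq_def intro!: divide_left_mono powr_mono2)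
  from summable_Leibniz(1)[OF lim this] show ?thesis
    by simp
qed

end

theory Submission
  imports Defs "HOL-Analysis.Analysis"
begin

text \<open>Integrating the series $\sum_m (-1)^m \cos((2m+1)x)/(2m+1) = \pi/4$, valid for
  $|x| < \pi/2$, termwise and repeatedly shows that $\sum_m (-1)^m \cos((2m+1)x)/(2m+1)^{2p+1}$
  is there a polynomial in $x$ whose coefficients are values of $\psi$ at odd integers.
  At $x = \pi/2$ every term of the series vanishes. With $\psi(2k+1) = C_k \pi^{2k+1}$ this says
  $\cosh(x/2) \sum_k (-1)^k C_k x^{2k} = 1/4$, and multiplication by $2 \sinh(x/2)$ gives
  $\sinh(x) \sum_k (-1)^k C_k x^{2k} = \sinh(x/2)/2$, which is the recurrence.\<close>

section \<open>Values of psi at odd integers\<close>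

lemma psi_odd_sums: "(\<lambda>m. (-1) ^ m / (2 * real m + 1) ^ (2 * p + 1)) sums psi (real (2 * p + 1))"
proof -
  have "(2 * real m + 1) powr real (2 * p + 1) = (2 * real m + 1) ^ (2 * p + 1)" for m
    by (rule powr_realpow) simp
  then show ?thesis
    using summable_sums[OF psi_summable[of "real (2 * p + 1)"]] unfolding psi_def by simp
qed

lemmas psi_odd = sums_unique[OF psi_odd_sums]

lemma psi_1: "psi 1 = pi / 4"
  using psi_odd[of 0] by (simp add: pi_series algebra_simps)

section \<open>Trigonometric series over odd frequencies; uniform convergence for exponent 1\<close>

definition cos_series :: "nat \<Rightarrow> real \<Rightarrow> real" where
  "cos_series p x = (\<Sum>m. (-1) ^ m * cos ((2 * real m + 1) * x) / (2 * real m + 1) ^ (2 * p + 1))"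

text \<open>The exponents interleave with those of \<open>cos_series\<close>: termwise,
  \<open>sin_series p\<close> has derivative \<open>cos_series p\<close>, and
  \<open>cos_series (Suc p)\<close> has derivative \<open>- sin_series p\<close>.\<close>

definition sin_series :: "nat \<Rightarrow> real \<Rightarrow> real" where
  "sin_series p x = (\<Sum>m. (-1) ^ m * sin ((2 * real m + 1) * x) / (2 * real m + 1) ^ (2 * p + 2))"

text \<open>Since 2 cos x sin((2m+1)x) = sin((2m+2)x) + sin(2mx), the alternating signs make the sum
  telescope.\<close>

lemma alternating_sin_sum:
  "2 * cos x * (\<Sum>m<M. (-1) ^ m * sin ((2 * real m + 1) * x)) = - ((-1) ^ M * sin (2 * real M * x))"
proof (induction M)
  case (Suc M)
  have "sin (2 * real (Suc M) * x) = sin ((2 * real M + 1) * x + x)"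
    "sin (2 * real M * x) = sin ((2 * real M + 1) * x - x)"
    by (simp_all add: algebra_simps)
  then have eq: "2 * cos x * sin ((2 * real M + 1) * x) = sin (2 * real (Suc M) * x) + sin (2 * real M * x)"
    unfolding sin_add sin_diff by simp
  have "2 * cos x * (\<Sum>m<Suc M. (-1) ^ m * sin ((2 * real m + 1) * x)) =
      - ((-1) ^ M * sin (2 * real M * x)) + (-1) ^ M * (2 * cos x * sin ((2 * real M + 1) * x))"
    by (simp only: sum.lessThan_Suc distrib_left Suc) simp
  also have "\<dots> = - ((-1) ^ Suc M * sin (2 * real (Suc M) * x))"
    unfolding eq distrib_left by simp
  finally show ?case .
qed simp

lemma cos_lower:
  fixes a x :: real
  assumes "a < pi / 2" "\<bar>x\<bar> \<le> a"
  shows "cos a \<le> cos x"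
  using assms cos_monotone_0_pi_le[of "\<bar>x\<bar>" a] by simp

text \<open>The derivative of the partial sum is an oscillating term of frequency $2M$ over $\cos x$;
  adding its integrated leading part, of size $O(1/M)$, leaves a function with derivative $O(1/M)$.\<close>

lemma uniform_limit_cos_partial:
  assumes "0 \<le> a" "a < pi / 2"
  shows "uniform_limit {-a..a}
           (\<lambda>M x. \<Sum>m<M. (-1) ^ m * cos ((2 * real m + 1) * x) / (2 * real m + 1) ^ (2 * 0 + 1))
           (\<lambda>_. pi / 4) sequentially"
proof -
  define s where "s M x = (\<Sum>m<M. (-1) ^ m * cos ((2 * real m + 1) * x) / (2 * real m + 1))" for M x
  define h where "h M x = s M x + (-1) ^ M * cos (2 * real M * x) / (4 * real M * cos x)" for M x
  define c where "c = cos a"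
  have c: "0 < c" "c \<le> 1"
    using assms by (simp_all add: c_def cos_gt_zero_pi)
  have cosx: "c \<le> cos x" "cos x > 0" if "x \<in> {-a..a}" for x
  proof -
    show "c \<le> cos x"
      unfolding c_def using that assms by (intro cos_lower) auto
    with c show "cos x > 0" by simp
  qed
  have ds: "(s M has_field_derivative - (\<Sum>m<M. (-1) ^ m * sin ((2 * real m + 1) * x))) (at x)" for M x
    unfolding s_def
    by (rule derivative_eq_intros refl | simp)+
       (simp add: sum_negf[symmetric] field_simps)
  have dh: "(h M has_field_derivative (-1) ^ M * cos (2 * real M * x) * sin x / (4 * real M * cos x ^ 2))
              (at x within {-a..a})"
    if "x \<in> {-a..a}" "M > 0" for M x
  proof -
    note cx = cosx[OF that(1)]
    have sum: "(\<Sum>m<M. (-1) ^ m * sin ((2 * real m + 1) * x)) = - ((-1) ^ M * sin (2 * real M * x)) / (2 * cos x)"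
      using alternating_sin_sum[of x M] cx by (simp add: field_simps)
    have "(h M has_field_derivative
        - (\<Sum>m<M. (-1) ^ m * sin ((2 * real m + 1) * x))
        + ((-1) ^ M * (- sin (2 * real M * x) * (2 * real M)) * (4 * real M * cos x)
           - (-1) ^ M * cos (2 * real M * x) * (4 * real M * - sin x))
          / (4 * real M * cos x * (4 * real M * cos x))) (at x within {-a..a})"
      unfolding h_def using cx that(2)
      by (auto intro!: derivative_eq_intros ds[THEN DERIV_subset])
    \<comment> \<open>The two terms in sin(2Mx) cancel; what remains comes from differentiating 1 /
      cos x in the correction term.\<close>
    also have "- (\<Sum>m<M. (-1) ^ m * sin ((2 * real m + 1) * x))
        + ((-1) ^ M * (- sin (2 * real M * x) * (2 * real M)) * (4 * real M * cos x)
           - (-1) ^ M * cos (2 * real M * x) * (4 * real M * - sin x))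
          / (4 * real M * cos x * (4 * real M * cos x))
        = (-1) ^ M * cos (2 * real M * x) * sin x / (4 * real M * cos x ^ 2)"
      unfolding sum using cx(2) that(2) by (simp add: field_simps power2_eq_square)
    finally show ?thesis .
  qed
  \<comment> \<open>Compare \<open>s M\<close> with \<open>h M\<close> at \<open>x\<close> and at 0:
    the mean value estimate for \<open>h M\<close> contributes \<open>a\<close>, the two correction
    terms contribute 2.\<close>
  have bound: "\<bar>s M x - s M 0\<bar> \<le> (a + 2) / (4 * c\<^sup>2) / real M" if "x \<in> {-a..a}" "M > 0" for M x
  proof -
    have "norm (h M x - h M 0) \<le> 1 / (4 * real M * c\<^sup>2) * norm (x - 0)"
    proof (rule field_differentiable_bound[OF _ dh])
      fix z assume z: "z \<in> {-a..a}"
      have 1: "\<bar>cos (2 * real M * z)\<bar> * \<bar>sin z\<bar> \<le> 1 * 1"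
        by (intro mult_mono) auto
      have "c\<^sup>2 \<le> (cos z)\<^sup>2"
        using cosx[OF z] c by (intro power_mono) auto
      then show "norm ((-1) ^ M * cos (2 * real M * z) * sin z / (4 * real M * cos z ^ 2))
          \<le> 1 / (4 * real M * c\<^sup>2)"
        using 1 c that(2) by (simp add: abs_mult power_abs) (intro frac_le; simp)
    qed (use that assms in auto)
    also have "\<dots> \<le> 1 / (4 * real M * c\<^sup>2) * a"
      using that by (intro mult_left_mono) auto
    finally have 1: "\<bar>h M x - h M 0\<bar> \<le> 1 / (4 * real M * c\<^sup>2) * a" by simp
    have 2: "\<bar>h M y - s M y\<bar> \<le> 1 / (4 * real M * c\<^sup>2)" if y: "y \<in> {-a..a}" for y
    proof -
      \<comment> \<open>As \<open>c\<close> is at most 1, the denominator cos y may be weakened to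
        \<open>c\<^sup>2\<close>, the one already present in the derivative bound.\<close>
      have "c * c \<le> 1 * cos y"
        using c cosx[OF y] by (intro mult_mono) auto
      then show ?thesis
        unfolding h_def using c cosx[OF y] \<open>M > 0\<close>
        by (simp add: abs_mult power_abs power2_eq_square) (intro frac_le; simp)
    qed
    have "\<bar>s M x - s M 0\<bar> \<le> 1 / (4 * real M * c\<^sup>2) * a + 1 / (4 * real M * c\<^sup>2) + 1 / (4 * real M * c\<^sup>2)"
      using 1 2[OF that(1)] 2[of 0] assms by auto
    also have "\<dots> = (a + 2) / (4 * c\<^sup>2) / real M"
      using c that(2) by (simp add: field_simps)
    finally show ?thesis .
  qed
  \<comment> \<open>At 0 the partial sums are those of the Leibniz series; this fixes the constant
    limit.\<close>
  have s0: "(\<lambda>M. s M 0) \<longlonglongrightarrow> pi / 4"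
    using psi_odd_sums[of 0] psi_1 by (simp add: s_def sums_def)
  have "uniform_limit {-a..a} (\<lambda>M x. s M x) (\<lambda>_. pi / 4) sequentially"
  proof (rule uniform_limitI)
    fix e :: real assume "e > 0"
    have "(\<lambda>M. (a + 2) / (4 * c\<^sup>2) / real M) \<longlonglongrightarrow> 0"
      by (rule lim_const_over_n)
    then have "(\<lambda>M. (a + 2) / (4 * c\<^sup>2) / real M + \<bar>s M 0 - pi / 4\<bar>) \<longlonglongrightarrow> 0 + \<bar>pi / 4 - pi / 4\<bar>"
      by (intro tendsto_intros s0)
    then have "\<forall>\<^sub>F M in sequentially. (a + 2) / (4 * c\<^sup>2) / real M + \<bar>s M 0 - pi / 4\<bar> < e"
      using \<open>e > 0\<close> by (intro order_tendstoD(2)) auto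
    then show "\<forall>\<^sub>F M in sequentially. \<forall>x\<in>{-a..a}. dist (s M x) (pi / 4) < e"
      using eventually_gt_at_top[of 0]
    proof eventually_elim
      case (elim M)
      show ?case
      proof
        fix x assume "x \<in> {-a..a}"
        from bound[OF this elim(2)] elim(1) show "dist (s M x) (pi / 4) < e"
          unfolding dist_real_def by linarith
      qed
    qed
  qed
  then show ?thesis
    by (simp add: s_def)
qed

section \<open>Uniform convergence for higher exponents\<close>

lemma summable_inverse_odd_power:
  assumes "n \<ge> 2"
  shows "summable (\<lambda>m. 1 / (2 * real m + 1) ^ n)"
proof (rule summable_comparison_test)
  have "1 / (2 * real m + 1) ^ n \<le> inverse (real (Suc m) ^ n)" for m
    unfolding inverse_eq_divide by (intro divide_left_mono power_mono) auto
  then show "\<exists>N. \<forall>m\<ge>N. norm (1 / (2 * real m + 1) ^ n) \<le> inverse (real (Suc m) ^ n)"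
    by simp
  show "summable (\<lambda>m. inverse (real (Suc m) ^ n))"
    using inverse_power_summable[OF assms, where 'a = real]
    by (subst summable_Suc_iff)
qed

lemma uniformly_convergent_trig_series:
  fixes t :: "real \<Rightarrow> real"
  assumes "n \<ge> 2" "\<And>y. \<bar>t y\<bar> \<le> 1"
  shows "uniformly_convergent_on S
    (\<lambda>M x. \<Sum>m<M. (-1) ^ m * t ((2 * real m + 1) * x) / (2 * real m + 1) ^ n)"
proof (rule Weierstrass_m_test')
  fix m x
  show "norm ((-1) ^ m * t ((2 * real m + 1) * x) / (2 * real m + 1) ^ n) \<le> 1 / (2 * real m + 1) ^ n"
    using assms(2) by (simp add: abs_mult power_abs divide_right_mono)
qed (rule summable_inverse_odd_power[OF assms(1)])

lemma summable_trig_series: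
  fixes t :: "real \<Rightarrow> real"
  assumes "n \<ge> 2" "\<And>y. \<bar>t y\<bar> \<le> 1"
  shows "summable (\<lambda>m. (-1) ^ m * t ((2 * real m + 1) * x) / (2 * real m + 1) ^ n)"
  using uniformly_convergent_imp_convergent[OF uniformly_convergent_trig_series[OF assms, of UNIV]]
  by (simp add: summable_iff_convergent)

text \<open>For \<open>p = 0\<close> the series of suprema diverges, so the Weierstrass test is
  replaced by the oscillation estimate. The interval stays away from pi / 2, where the sum of that
  series jumps from pi / 4 to 0.\<close>

lemma uniformly_convergent_cos_series:
  assumes "0 \<le> a" "a < pi / 2"
  shows "uniformly_convergent_on {-a..a}
    (\<lambda>M x. \<Sum>m<M. (-1) ^ m * cos ((2 * real m + 1) * x) / (2 * real m + 1) ^ (2 * p + 1))"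
proof (cases "p = 0")
  case True
  then show ?thesis
    using uniform_limit_cos_partial[OF assms] unfolding uniformly_convergent_on_def by blast
next
  case False
  then show ?thesis
    by (intro uniformly_convergent_trig_series) auto
qed

lemma cos_series_0:
  assumes "\<bar>x\<bar> < pi / 2"
  shows "cos_series 0 x = pi / 4"
proof -
  have "(\<lambda>M. \<Sum>m<M. (-1) ^ m * cos ((2 * real m + 1) * x) / (2 * real m + 1) ^ (2 * 0 + 1))
      \<longlonglongrightarrow> pi / 4"
    by (rule tendsto_uniform_limitI[OF uniform_limit_cos_partial[of "\<bar>x\<bar>"]]) (use assms in auto)
  then show ?thesis
    unfolding cos_series_def by (intro sums_unique[symmetric]) (simp add: sums_def)
qed

section \<open>Special values and termwise derivatives of the series\<close>

lemma cos_series_at_0: "cos_series p 0 = psi (real (2 * p + 1))"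
  unfolding psi_odd cos_series_def by simp

lemma sin_series_at_0: "sin_series p 0 = 0"
  unfolding sin_series_def by simp

lemma cos_odd_half_pi: "cos ((2 * real m + 1) * (pi / 2)) = 0"
  using cos_zero_iff[of "(2 * real m + 1) * (pi / 2)"] by (auto intro!: exI[of _ "2 * m + 1"])

lemma cos_series_at_half_pi: "cos_series p (pi / 2) = 0"
  unfolding cos_series_def cos_odd_half_pi by simp

text \<open>The derived series has exponent at least 2, so it converges uniformly on the whole line.
  The formula therefore includes x = pi / 2, where continuity is needed later.\<close>

lemma has_field_derivative_cos_series:
  "(cos_series (Suc p) has_field_derivative - sin_series p x) (at x)"
proof -
  have "((\<lambda>x. \<Sum>m. - ((-1) ^ m * cos ((2 * real m + 1) * x) / (2 * real m + 1) ^ (2 * Suc p + 1)))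
      has_field_derivative sin_series p x) (at x)"
    unfolding sin_series_def
  \<comment> \<open>Convergence at one point is required; at pi / 2 all terms vanish.\<close>
  proof (rule has_field_derivative_series'(2)[where S = UNIV and ?x0.0 = "pi / 2"])
    show "uniformly_convergent_on UNIV
      (\<lambda>M x. \<Sum>m<M. (-1) ^ m * sin ((2 * real m + 1) * x) / (2 * real m + 1) ^ (2 * p + 2))"
      by (rule uniformly_convergent_trig_series) auto
    show "summable (\<lambda>m. - ((-1) ^ m * cos ((2 * real m + 1) * (pi / 2)) / (2 * real m + 1) ^ (2 * Suc p + 1)))"
      unfolding cos_odd_half_pi by simp
  next
    fix m :: nat and x :: real
    show "((\<lambda>x. - ((-1) ^ m * cos ((2 * real m + 1) * x) / (2 * real m + 1) ^ (2 * Suc p + 1)))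
        has_field_derivative (-1) ^ m * sin ((2 * real m + 1) * x) / (2 * real m + 1) ^ (2 * p + 2)) (at x)"
      by (rule derivative_eq_intros refl | simp)+
  qed auto
  also have "(\<lambda>x. \<Sum>m. - ((-1) ^ m * cos ((2 * real m + 1) * x) / (2 * real m + 1) ^ (2 * Suc p + 1)))
      = (\<lambda>x. - cos_series (Suc p) x)"
    unfolding cos_series_def
    by (intro ext suminf_minus summable_trig_series) auto
  finally show ?thesis
    using DERIV_minus[of "\<lambda>x. - cos_series (Suc p) x"] by fastforce
qed

lemma has_field_derivative_sin_series:
  assumes "\<bar>x\<bar> < pi / 2"
  shows "(sin_series p has_field_derivative cos_series p x) (at x)"
proof -
  \<comment> \<open>The midpoint between \<bar>x\<bar> and pi / 2 makes \<open>x\<close> an interior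
    point of a compact interval on which the cosine series converges uniformly.\<close>
  define a where "a = (\<bar>x\<bar> + pi / 2) / 2"
  have a: "\<bar>x\<bar> < a" "a < pi / 2" "0 \<le> a"
    using assms by (auto simp: a_def)
  show ?thesis
    unfolding sin_series_def cos_series_def
  proof (rule has_field_derivative_series'(2)[where S = "{-a..a}" and ?x0.0 = 0])
    show "uniformly_convergent_on {-a..a}
      (\<lambda>M x. \<Sum>m<M. (-1) ^ m * cos ((2 * real m + 1) * x) / (2 * real m + 1) ^ (2 * p + 1))"
      using a by (intro uniformly_convergent_cos_series)
    fix m :: nat and y :: real
    show "((\<lambda>x. (-1) ^ m * sin ((2 * real m + 1) * x) / (2 * real m + 1) ^ (2 * p + 2))
        has_field_derivative (-1) ^ m * cos ((2 * real m + 1) * y) / (2 * real m + 1) ^ (2 * p + 1))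
        (at y within {-a..a})"
      by (rule derivative_eq_intros refl | simp)+
  qed (use a in auto)
qed

section \<open>Polynomials produced by repeated integration from 0\<close>

definition cos_poly :: "nat \<Rightarrow> real \<Rightarrow> real" where
  "cos_poly p x = (\<Sum>k\<le>p. (-1) ^ k * psi (real (2 * (p - k) + 1)) * (x ^ (2 * k) / fact (2 * k)))"

definition sin_poly :: "nat \<Rightarrow> real \<Rightarrow> real" where
  "sin_poly p x = (\<Sum>k\<le>p. (-1) ^ k * psi (real (2 * (p - k) + 1)) * (x ^ (2 * k + 1) / fact (2 * k + 1)))"

lemma has_field_derivative_power_over_fact:
  "((\<lambda>x::real. x ^ Suc n / fact (Suc n)) has_field_derivative x ^ n / fact n) (at x)"
  by (rule derivative_eq_intros refl | simp)+

lemma has_field_derivative_sin_poly: "(sin_poly p has_field_derivative cos_poly p x) (at x)"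
  unfolding sin_poly_def cos_poly_def Suc_eq_plus1[symmetric]
  by (intro DERIV_sum DERIV_cmult has_field_derivative_power_over_fact)

lemma has_field_derivative_cos_poly: "(cos_poly (Suc p) has_field_derivative - sin_poly p x) (at x)"
proof -
  \<comment> \<open>Splitting off the constant term and shifting the index turns
    \<open>Suc p - Suc k\<close> into \<open>p - k\<close> and leaves one extra sign, the minus in
    front of \<open>sin_poly\<close>.\<close>
  have eq: "cos_poly (Suc p) = (\<lambda>x. psi (real (2 * Suc p + 1)) +
    (\<Sum>k\<le>p. - ((-1) ^ k * psi (real (2 * (p - k) + 1))) * (x ^ Suc (2 * k + 1) / fact (Suc (2 * k + 1)))))"
    unfolding cos_poly_def sum.atMost_Suc_shift by (simp add: fun_eq_iff)
  have "- sin_poly p x = 0 +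
    (\<Sum>k\<le>p. - ((-1) ^ k * psi (real (2 * (p - k) + 1))) * (x ^ (2 * k + 1) / fact (2 * k + 1)))"
    unfolding sin_poly_def by (simp add: sum_negf[symmetric])
  then show ?thesis
    unfolding eq
    by (simp only:) (intro DERIV_add DERIV_const DERIV_sum DERIV_cmult has_field_derivative_power_over_fact)
qed

lemma cos_poly_at_0: "cos_poly p 0 = psi (real (2 * p + 1))"
proof (cases p)
  case (Suc q)
  show ?thesis
    unfolding Suc cos_poly_def sum.atMost_Suc_shift by simp
qed (simp add: cos_poly_def)

lemma sin_poly_at_0: "sin_poly p 0 = 0"
  by (simp add: sin_poly_def)

section \<open>Agreement of the series with the polynomials\<close>

lemma eq_of_deriv_eq:
  fixes f g f' :: "real \<Rightarrow> real"
  assumes "\<And>x. \<bar>x\<bar> < b \<Longrightarrow> (f has_field_derivative f' x) (at x)"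
    and "\<And>x. \<bar>x\<bar> < b \<Longrightarrow> (g has_field_derivative f' x) (at x)"
    and "f 0 = g 0" "\<bar>x\<bar> < b"
  shows "f x = g x"
proof -
  have "f x - g x = f 0 - g 0"
  proof (rule DERIV_isconst3[of "-b" b x 0 "\<lambda>x. f x - g x"])
    fix y assume "y \<in> {-b<..<b}"
    then show "((\<lambda>x. f x - g x) has_field_derivative 0) (at y)"
      using DERIV_diff[OF assms(1)[of y] assms(2)[of y]] by (simp add: abs_less_iff)
  qed (use assms(4) in auto)
  with assms(3) show ?thesis by simp
qed

text \<open>Starting from the constant pi / 4, integrate from 0 alternately: each sine stage has
  integration constant 0, each cosine stage has a value of psi at an odd integer. Each stage needs
  the one before it, so both equations are carried through the induction.\<close>

lemma trig_series_eq_poly: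
  assumes "\<bar>x\<bar> < pi / 2"
  shows "cos_series p x = cos_poly p x \<and> sin_series p x = sin_poly p x"
  using assms
proof (induction p arbitrary: x)
  case 0
  have cos: "cos_series 0 y = cos_poly 0 y" if "\<bar>y\<bar> < pi / 2" for y
    using cos_series_0[OF that] by (simp add: cos_poly_def psi_1)
  have "sin_series 0 x = sin_poly 0 x"
  proof (rule eq_of_deriv_eq[OF has_field_derivative_sin_series])
    fix y :: real assume "\<bar>y\<bar> < pi / 2"
    then show "(sin_poly 0 has_field_derivative cos_series 0 y) (at y)"
      using has_field_derivative_sin_poly[of 0 y] cos by simp
  qed (use 0 in \<open>auto simp: sin_series_at_0 sin_poly_at_0\<close>)
  with cos[OF 0] show ?case by simp
next
  case (Suc p)
  have cos: "cos_series (Suc p) y = cos_poly (Suc p) y" if "\<bar>y\<bar> < pi / 2" for y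
  proof (rule eq_of_deriv_eq[OF has_field_derivative_cos_series _ _ that])
    fix z :: real assume "\<bar>z\<bar> < pi / 2"
    then show "(cos_poly (Suc p) has_field_derivative - sin_series p z) (at z)"
      using has_field_derivative_cos_poly[of p z] Suc.IH by simp
  qed (simp add: cos_series_at_0 cos_poly_at_0)
  have "sin_series (Suc p) x = sin_poly (Suc p) x"
  proof (rule eq_of_deriv_eq[OF has_field_derivative_sin_series])
    fix y :: real assume "\<bar>y\<bar> < pi / 2"
    then show "(sin_poly (Suc p) has_field_derivative cos_series (Suc p) y) (at y)"
      using has_field_derivative_sin_poly[of "Suc p" y] cos by simp
  qed (use Suc.prems in \<open>auto simp: sin_series_at_0 sin_poly_at_0\<close>)
  with cos[OF Suc.prems] show ?case by simp
qed

text \<open>Agreement is known only on the open interval, but both sides are continuous at pi / 2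
  and share their left limit there. The index \<open>Suc p\<close> matters:
  \<open>cos_poly 0\<close> is the constant pi / 4.\<close>

lemma cos_poly_at_half_pi: "cos_poly (Suc p) (pi / 2) = 0"
proof -
  let ?F = "at_left (pi / 2)"
  have 1: "(cos_series (Suc p) \<longlongrightarrow> cos_series (Suc p) (pi / 2)) ?F"
    using DERIV_isCont[OF has_field_derivative_cos_series] isCont_def tendsto_within_subset by blast
  have 2: "(cos_poly (Suc p) \<longlongrightarrow> cos_poly (Suc p) (pi / 2)) ?F"
    using DERIV_isCont[OF has_field_derivative_cos_poly] isCont_def tendsto_within_subset by blast
  have "\<forall>\<^sub>F x in ?F. x \<in> {0<..<pi / 2}"
    by (rule eventually_at_left_real) simp
  then have "\<forall>\<^sub>F x in ?F. cos_series (Suc p) x = cos_poly (Suc p) x"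
    by eventually_elim (use trig_series_eq_poly in auto)
  then have "(cos_poly (Suc p) \<longlongrightarrow> cos_series (Suc p) (pi / 2)) ?F"
    using 1 tendsto_cong by blast
  then have "cos_poly (Suc p) (pi / 2) = cos_series (Suc p) (pi / 2)"
    using 2 by (intro tendsto_unique) auto
  then show ?thesis
    by (simp add: cos_series_at_half_pi)
qed

section \<open>Convolution identities for the quotients of psi by powers of pi\<close>

lemma sum_choose_even: "(\<Sum>k\<le>n. real (Suc (2 * n) choose (2 * k))) = 4 ^ n"
proof -
  \<comment> \<open>With i = 2k this is the even-indexed half of a binomial row, whose sum is half
    of 2^(2n+1).\<close>
  have "(\<Sum>k\<le>n. real (Suc (2 * n) choose (2 * k))) =
    (\<Sum>i\<in>{i. i \<le> Suc (2 * n) \<and> even i}. real (Suc (2 * n) choose i))"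
    by (rule sum.reindex_bij_witness[of _ "\<lambda>i. i div 2" "\<lambda>k. 2 * k"]) auto
  also have "\<dots> = (\<Sum>i\<le>Suc (2 * n). if even i then real (Suc (2 * n) choose i) else 0)"
    by (rule sum.mono_neutral_cong_left) auto
  finally show ?thesis
    using choose_even_sum[of "Suc (2 * n)", where 'a = real] by (simp add: power_mult)
qed

definition psi_quot :: "nat \<Rightarrow> real" where
  "psi_quot p = psi (real (2 * p + 1)) / pi ^ (2 * p + 1)"

lemma psi_quot_0: "psi_quot 0 = 1 / 4"
  by (simp add: psi_quot_def psi_1)

text \<open>For positive \<open>p\<close> this is the vanishing of \<open>cos_poly p\<close> at pi /
  2, rescaled by (-1)^p / pi^(2p+1); for \<open>p = 0\<close> it is the Leibniz value. Together
  these are the coefficients of the identity with cosh(x/2).\<close>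

lemma psi_quot_cosh_convolution:
  "(\<Sum>k\<le>p. (-1) ^ (p - k) * psi_quot (p - k) / (4 ^ k * fact (2 * k))) = (if p = 0 then 1 / 4 else 0)"
proof (cases p)
  case (Suc q)
  have "(-1) ^ (p - k) * psi_quot (p - k) / (4 ^ k * fact (2 * k)) =
      (-1) ^ p / pi ^ (2 * p + 1) *
        ((-1) ^ k * psi (real (2 * (p - k) + 1)) * ((pi / 2) ^ (2 * k) / fact (2 * k)))"
    if k: "k \<le> p" for k
  proof -
    obtain j where j: "p = k + j" using le_Suc_ex[OF k] by blast
    have half: "(pi / 2) ^ (2 * k) = pi ^ (2 * k) / 4 ^ k"
      by (simp add: power_divide power_mult)
    have pi: "pi ^ (2 * p + 1) = pi ^ (2 * j + 1) * pi ^ (2 * k)"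
      unfolding power_add[symmetric] j by (rule arg_cong[of _ _ "\<lambda>n. pi ^ n"]) simp
    have sign: "(-1) ^ p * (-1) ^ k = (-1 :: real) ^ j"
      by (simp add: j power_add)
    \<comment> \<open>Here \<open>r\<close> is pi^(2k), which cancels between the prefactor and the
      power of pi / 2.\<close>
    have cancel: "x / (q * r) * (y * z * (r / u / v)) = (x * y) * (z / q) / (u * v)"
      if "r \<noteq> 0" for x q r y z u v :: real
      using that by simp
    have "p - k = j" using j by simp
    then show ?thesis
      unfolding psi_quot_def half pi by (subst cancel) (simp_all only: sign, simp)
  qed
  then have "(\<Sum>k\<le>p. (-1) ^ (p - k) * psi_quot (p - k) / (4 ^ k * fact (2 * k))) =
      (-1) ^ p / pi ^ (2 * p + 1) * cos_poly p (pi / 2)"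
    unfolding cos_poly_def sum_distrib_left by (intro sum.cong) auto
  then show ?thesis
    using Suc cos_poly_at_half_pi by simp
qed (simp add: psi_quot_0)

text \<open>With $y = x^2$, the power series below are $\cosh(x/2)$, $\sinh(x)/x$ and $2\sinh(x/2)/x$,
  so \<open>U * W = V\<close> is the duplication formula for $\sinh$.\<close>

lemma psi_quot_convolution:
  "(\<Sum>k\<le>p. (-1) ^ k * psi_quot k / fact (2 * p + 1 - 2 * k)) = 1 / (4 ^ (p + 1) * fact (2 * p + 1))"
proof -
  define D where "D = Abs_fps (\<lambda>k. (-1) ^ k * psi_quot k)"
  define U :: "real fps" where "U = Abs_fps (\<lambda>k. 1 / (4 ^ k * fact (2 * k)))"
  define V :: "real fps" where "V = Abs_fps (\<lambda>k. 1 / fact (2 * k + 1))"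
  define W :: "real fps" where "W = Abs_fps (\<lambda>k. 1 / (4 ^ k * fact (2 * k + 1)))"
  have "U * D = fps_const (1 / 4)"
    by (rule fps_ext)
       (use psi_quot_cosh_convolution in
         \<open>simp add: fps_mult_nth U_def D_def atLeast0AtMost\<close>)
  have "U * W = V"
  proof (rule fps_ext)
    fix n
    \<comment> \<open>Over the common denominator (2n+1)! the inverse factorials combine to binomial
      coefficients; their sum 4^n then cancels the remaining power of 4.\<close>
    have "1 / (4 ^ k * fact (2 * k)) * (1 / (4 ^ (n - k) * fact (2 * (n - k) + 1))) =
        real (Suc (2 * n) choose (2 * k)) / (4 ^ n * fact (2 * n + 1))" if k: "k \<le> n" for k
    proof -
      obtain j where j: "n = k + j" using le_Suc_ex[OF k] by blast
      have "Suc (2 * n) - 2 * k = 2 * j + 1"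
        using j by simp
      then have "real (Suc (2 * n) choose (2 * k)) = fact (2 * n + 1) / (fact (2 * k) * fact (2 * j + 1))"
        using binomial_fact[of "2 * k" "Suc (2 * n)", where 'a = real] k
        by (simp del: fact_Suc binomial_Suc_Suc)
      moreover have "n - k = j" "(4 :: real) ^ n = 4 ^ k * 4 ^ j"
        using j by (simp_all add: power_add)
      ultimately show ?thesis
        by (simp del: fact_Suc binomial_Suc_Suc)
    qed
    then have "fps_nth (U * W) n = (\<Sum>k\<le>n. real (Suc (2 * n) choose (2 * k))) / (4 ^ n * fact (2 * n + 1))"
      unfolding fps_mult_nth U_def W_def atLeast0AtMost sum_divide_distrib by (intro sum.cong) auto
    then show "fps_nth (U * W) n = fps_nth V n"
      unfolding sum_choose_even by (simp add: V_def)
  qed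
  \<comment> \<open>Replacing \<open>V\<close> by \<open>U * W\<close> brings in the known product
    \<open>U * D\<close>, so \<open>D * V\<close> is \<open>W\<close> divided by 4.\<close>
  then have "D * V = (U * D) * W"
    by (simp add: mult_ac)
  then have "fps_nth (D * V) p = fps_nth (fps_const (1 / 4) * W) p"
    unfolding \<open>U * D = fps_const (1 / 4)\<close> by simp
  moreover have "fps_nth (D * V) p = (\<Sum>k\<le>p. (-1) ^ k * psi_quot k / fact (2 * p + 1 - 2 * k))"
    unfolding fps_mult_nth D_def V_def atLeast0AtMost
    by (intro sum.cong) (auto simp: Suc_diff_le diff_mult_distrib2 simp del: fact_Suc)
  moreover have "fps_nth (fps_const (1 / 4) * W) p = 1 / (4 ^ (p + 1) * fact (2 * p + 1))"
    by (simp add: W_def)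
  ultimately show ?thesis by argo
qed

section \<open>The recurrence and its rational solution\<close>

lemma psi_quot_rec:
  assumes "p \<ge> 1"
  shows "psi_quot p = (-1) ^ p / fact (2 * p + 1) *
    (1 / 4 ^ (p + 1) -
     (\<Sum>k = 0..p - 1. (-1) ^ k * (fact (2 * p + 1) / fact (2 * p + 1 - 2 * k)) * psi_quot k))"
proof -
  let ?f = "fact (2 * p + 1) :: real"
  define S where "S = (\<Sum>k = 0..p - 1. (-1) ^ k * psi_quot k / fact (2 * p + 1 - 2 * k))"
  \<comment> \<open>The term with index \<open>p\<close> has denominator \<open>fact 1\<close>, so
    the convolution can be solved for it.\<close>
  have "{..p} = insert p {0..p - 1}"
    using assms by auto
  then have "(-1) ^ p * psi_quot p + S = 1 / (4 ^ (p + 1) * ?f)"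
    using psi_quot_convolution[of p] assms by (simp add: S_def)
  then have "(-1) ^ p * psi_quot p = 1 / (4 ^ (p + 1) * ?f) - S"
    by linarith
  moreover have "psi_quot p = (-1) ^ p * ((-1) ^ p * psi_quot p)"
    by (simp flip: mult.assoc power_add)
  ultimately have "psi_quot p = (-1) ^ p * (1 / (4 ^ (p + 1) * ?f) - S)"
    by simp
  also have "\<dots> = (-1) ^ p / ?f * (1 / 4 ^ (p + 1) - ?f * S)"
    by (simp add: field_simps del: fact_Suc)
  also have "?f * S = (\<Sum>k = 0..p - 1. (-1) ^ k * (?f / fact (2 * p + 1 - 2 * k)) * psi_quot k)"
    unfolding S_def sum_distrib_left by (intro sum.cong refl) (simp del: fact_Suc)
  finally show ?thesis .
qed

text \<open>Rational values are built into the type. Every recursive call has its argument in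
  \<open>[0..<p]\<close>, hence below \<open>p\<close>, which gives termination.\<close>

fun coeff_C :: "nat \<Rightarrow> rat" where
  "coeff_C p = (if p = 0 then 1 / 4 else
     (-1) ^ p / fact (2 * p + 1) *
       (1 / 4 ^ (p + 1) -
        (\<Sum>k\<leftarrow>[0..<p]. (-1) ^ k * (fact (2 * p + 1) / fact (2 * p + 1 - 2 * k)) * coeff_C k)))"

declare coeff_C.simps [simp del]

lemma coeff_C_0: "coeff_C 0 = 1 / 4"
  by (simp add: coeff_C.simps)

lemma coeff_C_rec:
  assumes "p \<ge> 1"
  shows "coeff_C p = (-1) ^ p / fact (2 * p + 1) *
    (1 / 4 ^ (p + 1) -
     (\<Sum>k = 0..p - 1. (-1) ^ k * (fact (2 * p + 1) / fact (2 * p + 1 - 2 * k)) * coeff_C k))"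
proof -
  have "{0..p - 1} = set [0..<p]"
    using assms by auto
  then have sum_eq: "sum f {0..p - 1} = (\<Sum>k\<leftarrow>[0..<p]. f k)" for f :: "nat \<Rightarrow> rat"
    by (simp only: sum.distinct_set_conv_list distinct_upt)
  show ?thesis
    using assms unfolding sum_eq by (subst coeff_C.simps) simp
qed

lemma of_rat_fact: "of_rat (fact n) = (fact n :: real)"
  by (induction n) (simp_all add: of_rat_mult of_rat_add)

text \<open>Rationality of the quotients enters here: they obey the same recurrence as
  \<open>coeff_C\<close>, with the same initial value, so strong induction identifies them.\<close>

lemma of_rat_coeff_C: "of_rat (coeff_C p) = psi_quot p"
proof (induction p rule: less_induct)
  case (less p)
  show ?case
  proof (cases "p = 0")
    case True
    then show ?thesis
      by (simp add: coeff_C_0 psi_quot_0 of_rat_divide)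
  next
    case False
    then have p: "p \<ge> 1" by simp
    have "real_of_rat (coeff_C p) = (-1) ^ p / fact (2 * p + 1) *
      (1 / 4 ^ (p + 1) -
       (\<Sum>k = 0..p - 1. (-1) ^ k * (fact (2 * p + 1) / fact (2 * p + 1 - 2 * k)) * of_rat (coeff_C k)))"
      unfolding coeff_C_rec[OF p]
      by (simp only: of_rat_mult of_rat_divide of_rat_diff of_rat_sum of_rat_power of_rat_minus
          of_rat_fact of_rat_1 of_rat_numeral_eq of_rat_neg_one)
    also have "(\<Sum>k = 0..p - 1. (-1) ^ k * (fact (2 * p + 1) / fact (2 * p + 1 - 2 * k)) * of_rat (coeff_C k)) =
      (\<Sum>k = 0..p - 1. (-1) ^ k * (fact (2 * p + 1) / fact (2 * p + 1 - 2 * k)) * psi_quot k)"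
      using p less.IH by (intro sum.cong) (auto simp del: fact_Suc)
    finally show ?thesis
      unfolding psi_quot_rec[OF p] .
  qed
qed

theorem proposition7:
  "\<exists>C :: nat \<Rightarrow> rat.
     (\<forall>p. psi (real (2 * p + 1)) = of_rat (C p) * pi ^ (2 * p + 1)) \<and>
     (\<forall>D :: nat \<Rightarrow> rat. D = C \<longleftrightarrow>
        D 0 = 1 / 4 \<and>
        (\<forall>p\<ge>1. D p = (-1) ^ p / fact (2 * p + 1) *
           (1 / 4 ^ (p + 1) -
            (\<Sum>k = 0..p - 1. (-1) ^ k * (fact (2 * p + 1) / fact (2 * p + 1 - 2 * k)) * D k))))"
    (is "\<exists>C. _ \<and> (\<forall>D. D = C \<longleftrightarrow> ?R D)")
proof (rule exI[of _ coeff_C], intro conjI allI iffI impI)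
  show "psi (real (2 * p + 1)) = of_rat (coeff_C p) * pi ^ (2 * p + 1)" for p
    by (simp add: of_rat_coeff_C psi_quot_def)
next
  fix D :: "nat \<Rightarrow> rat"
  assume D: "?R D"
  \<comment> \<open>The right-hand side of the recurrence at \<open>p\<close> involves only indices
    below \<open>p\<close>, so strong induction forces uniqueness.\<close>
  have "D p = coeff_C p" for p
  proof (induction p rule: less_induct)
    case (less p)
    show ?case
    proof (cases "p = 0")
      case False
      then have p: "p \<ge> 1" by simp
      have eq: "(\<Sum>k = 0..p - 1. (-1) ^ k * (fact (2 * p + 1) / fact (2 * p + 1 - 2 * k)) * D k) =
        (\<Sum>k = 0..p - 1. (-1) ^ k * (fact (2 * p + 1) / fact (2 * p + 1 - 2 * k)) * coeff_C k)"
        using p less.IH by (intro sum.cong) auto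
      show ?thesis
        unfolding D[THEN conjunct2, rule_format, OF p] coeff_C_rec[OF p] eq ..
    qed (use D coeff_C_0 in simp)
  qed
  then show "D = coeff_C" by blast
next
  fix D assume "D = coeff_C"
  then show "D 0 = 1 / 4" by (simp add: coeff_C_0)
next
  fix D p assume "D = coeff_C" and p: "(1::nat) \<le> p"
  then show "D p = (-1) ^ p / fact (2 * p + 1) *
      (1 / 4 ^ (p + 1) -
       (\<Sum>k = 0..p - 1. (-1) ^ k * (fact (2 * p + 1) / fact (2 * p + 1 - 2 * k)) * D k))"
    using coeff_C_rec[OF p] by simp
qed

end
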